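(* Let $G$ be a finite simple graph with $n$ vertices ($n\ge 1$), and let $d_1 \leqslant \dots \leqslant d_n$ be the degrees of its vertices. Let $\tau(G)$ denote the number of spanning trees of $G$. Then $$\tau(G) \leqslant \frac{(1+d_1)(1+d_2)\cdots(1+d_n)}{n^2}.$$
   Context: A simple graph is an undirected graph without loops and without multiple edges. $\tau(G)$ is the number of spanning trees of $G$, i.e. of subgraphs of $G$ that are trees containing all vertices of $G$. *)

theory Defs
  imports Complex_Main "HOL-Library.Multiset"
begin

text \<open>
  Graphs are undirected: an edge is the two-element set of its endpoints, so that loops and
  multiple edges cannot occur. The notion of spanning tree in the AFP entry Graph_Theory is not
  suitable here: there an undirected graph is a symmetric digraph in which a walk u, v, u along two
  opposite arcs is already a cycle, so each undirected spanning tree would be counted once for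
  every orientation of its edges.
\<close>

type_synonym 'a ugraph = "'a set \<times> 'a set set"

abbreviation graph_verts :: "'a ugraph \<Rightarrow> 'a set" where
  "graph_verts G \<equiv> fst G"

abbreviation graph_edges :: "'a ugraph \<Rightarrow> 'a set set" where
  "graph_edges G \<equiv> snd G"

definition simple_graph :: "'a ugraph \<Rightarrow> bool" where
  "simple_graph G \<longleftrightarrow> (\<forall>e\<in>graph_edges G. e \<subseteq> graph_verts G \<and> card e = 2)"

definition finite_simple_graph :: "'a ugraph \<Rightarrow> bool" where
  "finite_simple_graph G \<longleftrightarrow> simple_graph G \<and> finite (graph_verts G)"

definition vertex_degree :: "'a ugraph \<Rightarrow> 'a \<Rightarrow> nat" where
  "vertex_degree G v = card {e \<in> graph_edges G. v \<in> e}"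

definition graph_walk :: "'a ugraph \<Rightarrow> 'a list \<Rightarrow> bool" where
  "graph_walk G xs \<longleftrightarrow>
     xs \<noteq> [] \<and> set xs \<subseteq> graph_verts G \<and> successively (\<lambda>u v. {u, v} \<in> graph_edges G) xs"

definition connected_graph :: "'a ugraph \<Rightarrow> bool" where
  "connected_graph G \<longleftrightarrow>
     graph_verts G \<noteq> {} \<and>
     (\<forall>u\<in>graph_verts G. \<forall>v\<in>graph_verts G. \<exists>xs. graph_walk G xs \<and> hd xs = u \<and> last xs = v)"

text \<open>A cycle is given by its pairwise distinct vertices; the closing edge is implicit.\<close>

definition graph_cycle :: "'a ugraph \<Rightarrow> 'a list \<Rightarrow> bool" where
  "graph_cycle G xs \<longleftrightarrow>
     graph_walk G xs \<and> distinct xs \<and> length xs \<ge> 3 \<and> {last xs, hd xs} \<in> graph_edges G"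

definition tree_graph :: "'a ugraph \<Rightarrow> bool" where
  "tree_graph G \<longleftrightarrow> simple_graph G \<and> connected_graph G \<and> \<not> (\<exists>xs. graph_cycle G xs)"

definition subgraph_of :: "'a ugraph \<Rightarrow> 'a ugraph \<Rightarrow> bool" where
  "subgraph_of H G \<longleftrightarrow>
     simple_graph H \<and> graph_verts H \<subseteq> graph_verts G \<and> graph_edges H \<subseteq> graph_edges G"

definition spanning_trees :: "'a ugraph \<Rightarrow> 'a ugraph set" where
  "spanning_trees G = {H. subgraph_of H G \<and> graph_verts H = graph_verts G \<and> tree_graph H}"

definition num_spanning_trees :: "'a ugraph \<Rightarrow> nat" where
  "num_spanning_trees G = card (spanning_trees G)"

lemma finite_graph_edges:
  assumes "finite_simple_graph G"
  shows "finite (graph_edges G)"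
  using assms finite_subset[of "graph_edges G" "Pow (graph_verts G)"]
  by (auto simp: finite_simple_graph_def simple_graph_def)

lemma finite_spanning_trees:
  assumes "finite_simple_graph G"
  shows "finite (spanning_trees G)"
proof (rule finite_subset)
  show "spanning_trees G \<subseteq> Pow (graph_verts G) \<times> Pow (graph_edges G)"
    by (auto simp: spanning_trees_def subgraph_of_def)
  show "finite (Pow (graph_verts G) \<times> Pow (graph_edges G))"
    using assms finite_graph_edges[OF assms] by (simp add: finite_simple_graph_def)
qed

end

theory Submission
  imports Defs "Jordan_Normal_Form.Determinant"
begin

text \<open>
  Let \<open>L\<close> be the Laplacian of \<open>G\<close> and \<open>J\<close> the all-ones matrix. Then \<open>L + J\<close> is the Gram matrix
  of the oriented incidence vectors of the edges together with the all-ones vector, so it is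
  positive semidefinite and Hadamard's inequality bounds its determinant by the product of its
  diagonal entries \<open>1 + d\<^sub>i\<close>. Conversely, by Cauchy-Binet the determinant is a sum of nonnegative
  contributions of sets of these vectors. For a spanning tree \<open>T\<close>, the only nonzero contribution
  inside \<open>T\<close> plus the all-ones vector is that of the whole set, since dropping any vector makes
  the Gram matrix singular; it equals \<open>det (L\<^sub>T + J)\<close>, which is positive and an integer multiple of
  \<open>n\<^sup>2\<close>. Hence \<open>n\<^sup>2 \<tau>(G) \<le> det (L + J)\<close>. This is the part of the matrix-tree theorem that is
  needed, and it does not require counting the edges of a tree.
\<close>

section \<open>Positive semidefinite matrices and Hadamard's inequality\<close>

abbreviation fun_det :: "nat \<Rightarrow> (nat \<Rightarrow> nat \<Rightarrow> 'a :: comm_ring_1) \<Rightarrow> 'a" where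
  "fun_det n a \<equiv> det (mat n n (\<lambda>(i, j). a i j))"

text \<open>One step of block elimination: the unipotent factor \<open>?L\<close> clears the first
  column below the pivot and leaves the Schur complement, so the determinant splits.\<close>

lemma fun_det_Suc_pivot:
  fixes a :: "nat \<Rightarrow> nat \<Rightarrow> real"
  assumes "a 0 0 \<noteq> 0"
  shows "fun_det (Suc n) a =
    a 0 0 * fun_det n (\<lambda>i j. a (Suc i) (Suc j) - a (Suc i) 0 * a 0 (Suc j) / a 0 0)"
proof -
  let ?c = "mat n 1 (\<lambda>(i, j). - a (Suc i) 0 / a 0 0)"
  let ?L = "four_block_mat (1\<^sub>m 1) (0\<^sub>m 1 n) ?c (1\<^sub>m n)"
  let ?A1 = "mat 1 1 (\<lambda>_. a 0 0)"
  let ?A2 = "mat 1 n (\<lambda>(i, j). a 0 (Suc j))"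
  let ?A3 = "mat n 1 (\<lambda>(i, j). a (Suc i) 0)"
  let ?A4 = "mat n n (\<lambda>(i, j). a (Suc i) (Suc j))"
  let ?S = "mat n n (\<lambda>(i, j). a (Suc i) (Suc j) - a (Suc i) 0 * a 0 (Suc j) / a 0 0)"
  let ?A = "mat (Suc n) (Suc n) (\<lambda>(i, j). a i j)"
  have A: "?A = four_block_mat ?A1 ?A2 ?A3 ?A4"
    by (rule eq_matI) (auto simp: not_less_eq)
  have "?L * ?A = four_block_mat (1\<^sub>m 1 * ?A1 + 0\<^sub>m 1 n * ?A3) (1\<^sub>m 1 * ?A2 + 0\<^sub>m 1 n * ?A4)
      (?c * ?A1 + 1\<^sub>m n * ?A3) (?c * ?A2 + 1\<^sub>m n * ?A4)"
    unfolding A by (rule mult_four_block_mat) auto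
  also have "1\<^sub>m 1 * ?A1 + 0\<^sub>m 1 n * ?A3 = ?A1"
    by (subst left_mult_one_mat) auto
  also have "1\<^sub>m 1 * ?A2 + 0\<^sub>m 1 n * ?A4 = ?A2"
    by (subst left_mult_one_mat) auto
  also have "?c * ?A1 + 1\<^sub>m n * ?A3 = 0\<^sub>m n 1"
    using assms by (subst left_mult_one_mat) (auto intro!: eq_matI simp: scalar_prod_def)
  also have "?c * ?A2 + 1\<^sub>m n * ?A4 = ?S"
    by (subst left_mult_one_mat) (auto intro!: eq_matI simp: scalar_prod_def)
  finally have "det (?L * ?A) = det ?A1 * det ?S"
    by (simp add: det_four_block_mat_lower_left_zero[where n = 1 and m = n])
  moreover have "det (?L * ?A) = det ?L * det ?A"
    by (rule det_mult[where n = "Suc n"]) auto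
  moreover have "det ?L = 1"
    by (subst det_four_block_mat_upper_right_zero[where n = 1 and m = n]) auto
  moreover have "det ?A1 = a 0 0"
    by (simp add: det_single)
  ultimately show ?thesis by simp
qed

lemma fun_det_eq_0_iff:
  fixes a :: "nat \<Rightarrow> nat \<Rightarrow> 'a :: idom"
  shows "fun_det n a = 0 \<longleftrightarrow>
    (\<exists>x. (\<exists>i<n. x i \<noteq> 0) \<and> (\<forall>i<n. (\<Sum>j<n. a i j * x j) = 0))"
proof -
  have mv: "mat n n (\<lambda>(i, j). a i j) *\<^sub>v v = vec n (\<lambda>i. \<Sum>j<n. a i j * v $ j)"
    if "v \<in> carrier_vec n" for v
    using that by (intro eq_vecI) (auto simp: scalar_prod_def lessThan_atLeast0)
  have "fun_det n a = 0 \<longleftrightarrow> (\<exists>v. v \<in> carrier_vec n \<and> v \<noteq> 0\<^sub>v n \<and>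
      mat n n (\<lambda>(i, j). a i j) *\<^sub>v v = 0\<^sub>v n)"
    by (rule det_0_iff_vec_prod_zero) simp
  also have "\<dots> \<longleftrightarrow> (\<exists>x. (\<exists>i<n. x i \<noteq> 0) \<and> (\<forall>i<n. (\<Sum>j<n. a i j * x j) = 0))"
    (is "?l \<longleftrightarrow> ?r")
  proof
    assume ?l
    then obtain v where v: "v \<in> carrier_vec n" "v \<noteq> 0\<^sub>v n"
      "vec n (\<lambda>i. \<Sum>j<n. a i j * v $ j) = 0\<^sub>v n"
      using mv by auto
    have "\<exists>i<n. v $ i \<noteq> 0" using v(1,2) by (metis carrier_vecD eq_vecI index_zero_vec)
    moreover have "(\<Sum>j<n. a i j * v $ j) = 0" if "i < n" for i
      using arg_cong[OF v(3), of "\<lambda>w. w $ i"] that by simp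
    ultimately show ?r by (intro exI[of _ "\<lambda>i. v $ i"]) auto
  next
    assume ?r
    then obtain x i where x: "i < n" "x i \<noteq> 0" "\<forall>i<n. (\<Sum>j<n. a i j * x j) = 0" by auto
    have "vec n x \<noteq> 0\<^sub>v n" using x(1,2) by (metis index_vec index_zero_vec(1))
    moreover have "mat n n (\<lambda>(i, j). a i j) *\<^sub>v vec n x = 0\<^sub>v n"
      using x(3) by (subst mv) (auto intro!: eq_vecI)
    ultimately show ?l by (intro exI[of _ "vec n x"]) auto
  qed
  finally show ?thesis .
qed

definition psd :: "nat \<Rightarrow> (nat \<Rightarrow> nat \<Rightarrow> real) \<Rightarrow> bool" where
  "psd n a \<longleftrightarrow> (\<forall>i<n. \<forall>j<n. a i j = a j i) \<and>
    (\<forall>x. 0 \<le> (\<Sum>i<n. \<Sum>j<n. x i * a i j * x j))"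

lemma psd_quadratic_form_nonneg:
  "psd n a \<Longrightarrow> 0 \<le> (\<Sum>i<n. \<Sum>j<n. x i * a i j * x j)"
  by (simp add: psd_def)

lemma sum_mult_of_bool_single:
  fixes f :: "nat \<Rightarrow> 'a :: semiring_1"
  assumes "i < n"
  shows "(\<Sum>k<n. f k * of_bool (k = i)) = f i" "(\<Sum>k<n. of_bool (k = i) * f k) = f i"
proof -
  have "{..<n} \<inter> {k. k = i} = {i}" using assms by auto
  then show "(\<Sum>k<n. f k * of_bool (k = i)) = f i" "(\<Sum>k<n. of_bool (k = i) * f k) = f i"
    by (simp_all add: sum_mult_of_bool_eq sum_of_bool_mult_eq)
qed

lemma psd_diag_nonneg:
  assumes "psd n a" "i < n"
  shows "0 \<le> a i i"
proof -
  have "0 \<le> (\<Sum>k<n. \<Sum>l<n. of_bool (k = i) * a k l * of_bool (l = i))"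
    using assms(1) by (rule psd_quadratic_form_nonneg)
  also have "\<dots> = a i i"
    using assms(2) by (simp only: sum_mult_of_bool_single)
  finally show ?thesis .
qed

lemma quadratic_form_Suc:
  fixes a :: "nat \<Rightarrow> nat \<Rightarrow> real"
  assumes "\<forall>i<Suc n. \<forall>j<Suc n. a i j = a j i"
  shows "(\<Sum>i<Suc n. \<Sum>j<Suc n. x i * a i j * x j) =
    a 0 0 * (x 0)\<^sup>2 + 2 * x 0 * (\<Sum>j<n. a 0 (Suc j) * x (Suc j)) +
    (\<Sum>i<n. \<Sum>j<n. x (Suc i) * a (Suc i) (Suc j) * x (Suc j))"
proof -
  have "(\<Sum>i<n. x (Suc i) * a (Suc i) 0 * x 0) = x 0 * (\<Sum>j<n. a 0 (Suc j) * x (Suc j))"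
    unfolding sum_distrib_left using assms by (intro sum.cong) auto
  moreover have "(\<Sum>j<n. x 0 * a 0 (Suc j) * x (Suc j)) = x 0 * (\<Sum>j<n. a 0 (Suc j) * x (Suc j))"
    unfolding sum_distrib_left by (intro sum.cong) auto
  ultimately show ?thesis
    by (simp add: sum.lessThan_Suc_shift sum.distrib power2_eq_square del: sum.lessThan_Suc)
qed

text \<open>With a zero pivot the form is affine in \<open>x 0\<close>, so a nonzero entry in row 0
  would let it become negative.\<close>

lemma psd_zero_pivot:
  assumes psd: "psd (Suc n) a" and 0: "a 0 0 = 0" and j: "j < n"
  shows "a 0 (Suc j) = 0"
proof (rule ccontr)
  assume nz: "a 0 (Suc j) \<noteq> 0"
  \<comment> \<open>This \<open>t\<close> makes the form equal to -1 at the vector with entries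
    \<open>t\<close> at 0 and 1 at \<open>Suc j\<close>.\<close>
  define t where "t = - (a (Suc j) (Suc j) + 1) / (2 * a 0 (Suc j))"
  define x :: "nat \<Rightarrow> real" where "x = (\<lambda>i. if i = 0 then t else of_bool (i = Suc j))"
  have "0 \<le> (\<Sum>i<Suc n. \<Sum>j<Suc n. x i * a i j * x j)"
    using psd by (rule psd_quadratic_form_nonneg)
  also have "\<dots> = a 0 0 * (x 0)\<^sup>2 + 2 * x 0 * (\<Sum>j<n. a 0 (Suc j) * x (Suc j)) +
    (\<Sum>i<n. \<Sum>j<n. x (Suc i) * a (Suc i) (Suc j) * x (Suc j))"
    using psd unfolding psd_def by (intro quadratic_form_Suc) blast
  also have "\<dots> = 2 * t * a 0 (Suc j) + a (Suc j) (Suc j)"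
    using j 0 by (simp add: x_def sum_mult_of_bool_single del: sum_mult_of_bool_eq sum_of_bool_mult_eq)
  finally have "0 \<le> 2 * t * a 0 (Suc j) + a (Suc j) (Suc j)" .
  moreover have "2 * t * a 0 (Suc j) = - (a (Suc j) (Suc j) + 1)" using nz by (simp add: t_def)
  ultimately show False by linarith
qed

text \<open>Completing the square: the Schur form at \<open>y\<close> is the minimum of the original
  form over the free first coordinate.\<close>

lemma psd_Schur_complement:
  assumes psd: "psd (Suc n) a" and pos: "a 0 0 > 0"
  shows "psd n (\<lambda>i j. a (Suc i) (Suc j) - a (Suc i) 0 * a 0 (Suc j) / a 0 0)"
  unfolding psd_def
proof (intro conjI allI impI)
  have sym: "\<forall>i<Suc n. \<forall>j<Suc n. a i j = a j i" using psd unfolding psd_def by blast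
  fix i j assume "i < n" "j < n"
  then show "a (Suc i) (Suc j) - a (Suc i) 0 * a 0 (Suc j) / a 0 0 =
    a (Suc j) (Suc i) - a (Suc j) 0 * a 0 (Suc i) / a 0 0"
    using sym by simp
next
  have sym: "\<forall>i<Suc n. \<forall>j<Suc n. a i j = a j i" using psd unfolding psd_def by blast
  fix y :: "nat \<Rightarrow> real"
  let ?s = "\<Sum>j<n. a 0 (Suc j) * y j"
  \<comment> \<open>The new first coordinate is the minimizer for the given
    \<open>y\<close>.\<close>
  define x where "x = case_nat (- ?s / a 0 0) y"
  have "(\<Sum>i<n. \<Sum>j<n. y i * (a (Suc i) 0 * a 0 (Suc j) / a 0 0) * y j) =
      (\<Sum>i<n. \<Sum>j<n. (a 0 (Suc i) * y i) * (a 0 (Suc j) * y j) / a 0 0)"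
    using sym by (intro sum.cong refl) auto
  also have "\<dots> = ?s * ?s / a 0 0"
    by (simp add: sum_product sum_divide_distrib)
  finally have s: "(\<Sum>i<n. \<Sum>j<n. y i * (a (Suc i) 0 * a 0 (Suc j) / a 0 0) * y j) =
    ?s * ?s / a 0 0" .
  have "0 \<le> (\<Sum>i<Suc n. \<Sum>j<Suc n. x i * a i j * x j)"
    using psd by (rule psd_quadratic_form_nonneg)
  also have "\<dots> = (\<Sum>i<n. \<Sum>j<n. y i * a (Suc i) (Suc j) * y j) - ?s * ?s / a 0 0"
    unfolding quadratic_form_Suc[OF sym]
    using pos by (simp add: x_def power2_eq_square field_simps)
  also have "\<dots> = (\<Sum>i<n. \<Sum>j<n.
      y i * (a (Suc i) (Suc j) - a (Suc i) 0 * a 0 (Suc j) / a 0 0) * y j)"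
    unfolding s[symmetric] by (simp only: sum_subtractf[symmetric] right_diff_distrib left_diff_distrib)
  finally show "0 \<le> (\<Sum>i<n. \<Sum>j<n.
      y i * (a (Suc i) (Suc j) - a (Suc i) 0 * a 0 (Suc j) / a 0 0) * y j)" .
qed

text \<open>Induction by elimination: the determinant is the pivot times that of the Schur
  complement, which is again positive semidefinite and whose diagonal entries have only
  decreased.\<close>

lemma psd_hadamard:
  assumes "psd n a"
  shows "0 \<le> fun_det n a \<and> fun_det n a \<le> (\<Prod>i<n. a i i)"
  using assms
proof (induction n arbitrary: a)
  case 0
  then show ?case by simp
next
  case (Suc n)
  show ?case
  proof (cases "a 0 0 = 0")
    case True
    \<comment> \<open>A zero pivot kills all of column 0, so the first unit vector lies in the
      kernel.\<close>
    have "a i 0 = 0" if "i < Suc n" for i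
      using that True psd_zero_pivot[OF Suc.prems True] Suc.prems unfolding psd_def
      by (cases i) auto
    then have "fun_det (Suc n) a = 0"
      unfolding fun_det_eq_0_iff
      by (intro exI[of _ "\<lambda>i. of_bool (i = 0)"])
        (auto simp: sum_mult_of_bool_single simp del: sum.lessThan_Suc sum_mult_of_bool_eq)
    moreover have "0 \<le> (\<Prod>i<Suc n. a i i)"
      using psd_diag_nonneg[OF Suc.prems] by (intro prod_nonneg) auto
    ultimately show ?thesis by simp
  next
    case False
    then have pos: "a 0 0 > 0" using psd_diag_nonneg[OF Suc.prems, of 0] by simp
    let ?S = "\<lambda>i j. a (Suc i) (Suc j) - a (Suc i) 0 * a 0 (Suc j) / a 0 0"
    have S: "psd n ?S" by (rule psd_Schur_complement[OF Suc.prems pos])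
    have IH: "0 \<le> fun_det n ?S" "fun_det n ?S \<le> (\<Prod>i<n. ?S i i)" using Suc.IH[OF S] by auto
    have "(\<Prod>i<n. ?S i i) \<le> (\<Prod>i<n. a (Suc i) (Suc i))"
    proof (rule prod_mono, intro conjI)
      fix i assume i: "i \<in> {..<n}"
      show "0 \<le> ?S i i" using psd_diag_nonneg[OF S] i by simp
      have "a (Suc i) 0 = a 0 (Suc i)" using Suc.prems i unfolding psd_def by simp
      then show "?S i i \<le> a (Suc i) (Suc i)" using pos by simp
    qed
    with IH(2) have "a 0 0 * fun_det n ?S \<le> a 0 0 * (\<Prod>i<n. a (Suc i) (Suc i))"
      using pos by (intro mult_left_mono) auto
    then show ?thesis
      using IH(1) pos fun_det_Suc_pivot[of a n] False
      by (simp add: prod.lessThan_Suc_shift del: prod.lessThan_Suc)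
  qed
qed

section \<open>Gram determinants\<close>

definition gram :: "('k \<Rightarrow> nat \<Rightarrow> real) \<Rightarrow> 'k set \<Rightarrow> nat \<Rightarrow> nat \<Rightarrow> real" where
  "gram v K i j = (\<Sum>k\<in>K. v k i * v k j)"

lemma quadratic_form_gram:
  "(\<Sum>i<n. \<Sum>j<n. x i * gram v K i j * x j) = (\<Sum>k\<in>K. (\<Sum>i<n. v k i * x i)\<^sup>2)"
proof -
  have "(\<Sum>i<n. \<Sum>j<n. x i * gram v K i j * x j) =
    (\<Sum>i<n. \<Sum>j<n. \<Sum>k\<in>K. (v k i * x i) * (v k j * x j))"
    unfolding gram_def sum_distrib_left sum_distrib_right by (intro sum.cong refl) simp
  also have "\<dots> = (\<Sum>i<n. \<Sum>k\<in>K. \<Sum>j<n. (v k i * x i) * (v k j * x j))"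
    by (intro sum.cong refl sum.swap)
  also have "\<dots> = (\<Sum>k\<in>K. \<Sum>i<n. \<Sum>j<n. (v k i * x i) * (v k j * x j))"
    by (rule sum.swap)
  also have "\<dots> = (\<Sum>k\<in>K. (\<Sum>i<n. v k i * x i)\<^sup>2)"
    by (simp add: power2_eq_square sum_product)
  finally show ?thesis .
qed

lemma psd_gram: "psd n (gram v K)"
  unfolding psd_def quadratic_form_gram
proof (intro conjI allI impI)
  show "gram v K i j = gram v K j i" for i j
    by (simp add: gram_def mult.commute)
  show "0 \<le> (\<Sum>k\<in>K. (\<Sum>i<n. v k i * x i)\<^sup>2)" for x
    by (intro sum_nonneg) simp
qed

text \<open>A kernel vector makes the quadratic form vanish; as the form is a sum of squares, the
  vector is orthogonal to every \<open>v k\<close>.\<close>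

lemma fun_det_gram_eq_0_iff:
  assumes "finite K"
  shows "fun_det n (gram v K) = 0 \<longleftrightarrow>
    (\<exists>x. (\<exists>i<n. x i \<noteq> 0) \<and> (\<forall>k\<in>K. (\<Sum>i<n. v k i * x i) = 0))"
proof -
  have "(\<forall>i<n. (\<Sum>j<n. gram v K i j * x j) = 0) \<longleftrightarrow> (\<forall>k\<in>K. (\<Sum>i<n. v k i * x i) = 0)"
    (is "?l \<longleftrightarrow> ?r") for x
  proof
    assume ?l
    then have "(\<Sum>i<n. x i * (\<Sum>j<n. gram v K i j * x j)) = 0" by simp
    then have "(\<Sum>k\<in>K. (\<Sum>i<n. v k i * x i)\<^sup>2) = 0"
      unfolding quadratic_form_gram[symmetric] by (simp add: sum_distrib_left mult.assoc)
    then show ?r using assms by (simp add: sum_nonneg_eq_0_iff)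
  next
    assume r: ?r
    have "(\<Sum>j<n. gram v K i j * x j) = (\<Sum>k\<in>K. v k i * (\<Sum>j<n. v k j * x j))" for i
      unfolding gram_def sum_distrib_right sum_distrib_left
      by (subst sum.swap) (simp add: mult.assoc)
    then show ?l using r by simp
  qed
  then show ?thesis unfolding fun_det_eq_0_iff by simp
qed

section \<open>The Cauchy-Binet expansion of a Gram determinant\<close>

definition cauchy_binet_term :: "nat \<Rightarrow> ('k \<Rightarrow> nat \<Rightarrow> real) \<Rightarrow> (nat \<Rightarrow> 'k) \<Rightarrow> real" where
  "cauchy_binet_term n v f = (\<Prod>i<n. v (f i) i) * fun_det n (\<lambda>i j. v (f i) j)"

text \<open>
  For \<open>card R = n\<close> this is the squared determinant formed from the vectors in \<open>R\<close>, as in the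
  Cauchy-Binet formula; otherwise it is zero. Grouping by images avoids ordering \<open>R\<close>.
\<close>

definition cauchy_binet_coeff :: "nat \<Rightarrow> ('k \<Rightarrow> nat \<Rightarrow> real) \<Rightarrow> 'k set \<Rightarrow> real" where
  "cauchy_binet_coeff n v R =
    (\<Sum>f | f \<in> {..<n} \<rightarrow>\<^sub>E R \<and> f ` {..<n} = R. cauchy_binet_term n v f)"

text \<open>Multilinearity in the rows: row \<open>i\<close> is the sum over \<open>k\<close> of
  \<open>v k i\<close> times the vector \<open>v k\<close>, and \<open>f\<close> records which
  \<open>k\<close> is chosen in each row. The proof distributes the products in the Leibniz
  formula.\<close>

lemma fun_det_gram_expand:
  assumes "finite K"
  shows "fun_det n (gram v K) = (\<Sum>f\<in>{..<n} \<rightarrow>\<^sub>E K. cauchy_binet_term n v f)"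
proof -
  let ?P = "{p. p permutes {0..<n}}"
  have "fun_det n (gram v K) = (\<Sum>p\<in>?P. signof p * (\<Prod>i<n. gram v K i (p i)))"
    by (subst det_def'[of _ n]) (auto intro!: sum.cong prod.cong simp: lessThan_atLeast0 permutes_in_image)
  also have "\<dots> = (\<Sum>p\<in>?P. signof p * (\<Sum>f\<in>{..<n} \<rightarrow>\<^sub>E K. \<Prod>i<n. v (f i) i * v (f i) (p i)))"
    unfolding gram_def using assms by (subst prod_sum_PiE) auto
  also have "\<dots> = (\<Sum>f\<in>{..<n} \<rightarrow>\<^sub>E K. \<Sum>p\<in>?P. signof p * (\<Prod>i<n. v (f i) i * v (f i) (p i)))"
    unfolding sum_distrib_left by (rule sum.swap)
  also have "\<dots> = (\<Sum>f\<in>{..<n} \<rightarrow>\<^sub>E K. cauchy_binet_term n v f)"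
  proof (rule sum.cong[OF refl])
    fix f
    have "fun_det n (\<lambda>i j. v (f i) j) = (\<Sum>p\<in>?P. signof p * (\<Prod>i<n. v (f i) (p i)))"
      by (subst det_def'[of _ n]) (auto intro!: sum.cong prod.cong simp: lessThan_atLeast0 permutes_in_image)
    then show "(\<Sum>p\<in>?P. signof p * (\<Prod>i<n. v (f i) i * v (f i) (p i))) = cauchy_binet_term n v f"
      unfolding cauchy_binet_term_def by (simp add: prod.distrib sum_distrib_left mult_ac)
  qed
  finally show ?thesis .
qed

lemma fun_det_gram_eq_sum_coeff:
  assumes "finite K"
  shows "fun_det n (gram v K) = (\<Sum>R\<in>Pow K. cauchy_binet_coeff n v R)"
proof -
  have "(\<Sum>R\<in>Pow K. \<Sum>f | f \<in> {..<n} \<rightarrow>\<^sub>E K \<and> f ` {..<n} = R. cauchy_binet_term n v f) =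
    (\<Sum>f\<in>{..<n} \<rightarrow>\<^sub>E K. cauchy_binet_term n v f)"
    using assms by (intro sum.group) (auto intro!: finite_PiE)
  moreover have "{f. f \<in> {..<n} \<rightarrow>\<^sub>E K \<and> f ` {..<n} = R} = {f. f \<in> {..<n} \<rightarrow>\<^sub>E R \<and> f ` {..<n} = R}"
    if "R \<subseteq> K" for R
    using that by (auto simp: PiE_def Pi_def)
  ultimately show ?thesis
    unfolding fun_det_gram_expand[OF assms] cauchy_binet_coeff_def by simp
qed

text \<open>By pigeonhole \<open>f\<close> chooses some vector twice, which gives two equal
  rows.\<close>

lemma cauchy_binet_coeff_small:
  assumes "card R < n" "finite R"
  shows "cauchy_binet_coeff n v R = 0"
  unfolding cauchy_binet_coeff_def
proof (rule sum.neutral, safe)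
  fix f assume "R = f ` {..<n}" 
  then have "\<not> inj_on f {..<n}" using assms by (auto simp: card_image)
  then obtain i j where ij: "i < n" "j < n" "i \<noteq> j" "f i = f j" by (auto simp: inj_on_def)
  have "fun_det n (\<lambda>i j. v (f i) j) = 0"
    by (rule det_identical_rows[of _ n i j]) (use ij in auto)
  then show "cauchy_binet_term n v f = 0" by (simp add: cauchy_binet_term_def)
qed

lemma cauchy_binet_coeff_nonneg:
  assumes "finite R"
  shows "0 \<le> cauchy_binet_coeff n v R"
proof (cases "card R" n rule: linorder_cases)
  case less
  then show ?thesis using cauchy_binet_coeff_small[of R n v] assms by simp
next
  case equal
  txt \<open>The coefficient is the full Gram determinant of \<open>R\<close>, as all smaller subsets contribute zero.\<close>
  have "fun_det n (gram v R) =
      cauchy_binet_coeff n v R + (\<Sum>S\<in>Pow R - {R}. cauchy_binet_coeff n v S)"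
    unfolding fun_det_gram_eq_sum_coeff[OF assms] using assms by (intro sum.remove) auto
  also have "(\<Sum>S\<in>Pow R - {R}. cauchy_binet_coeff n v S) = 0"
  proof (rule sum.neutral, rule ballI)
    fix S assume "S \<in> Pow R - {R}"
    then have "S \<subset> R" by auto
    then show "cauchy_binet_coeff n v S = 0"
      using assms equal psubset_card_mono[of R S]
      by (intro cauchy_binet_coeff_small) (auto intro: finite_subset)
  qed
  finally show ?thesis using psd_hadamard[OF psd_gram, of n v R] by simp
next
  case greater
  have "f ` {..<n} \<noteq> R" for f
    using greater card_image_le[of "{..<n}" f] by auto
  then show ?thesis unfolding cauchy_binet_coeff_def by simp
qed

text \<open>Minimality collapses each determinant on the left to the single coefficient of
  \<open>T\<close>. The right side is the sum of all coefficients, and the further ones are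
  nonnegative.\<close>

lemma sum_fun_det_gram_le:
  assumes K: "finite K" and F: "F \<subseteq> Pow K"
    and minimal: "\<And>T R. T \<in> F \<Longrightarrow> R \<subset> T \<Longrightarrow> fun_det n (gram v R) = 0"
  shows "(\<Sum>T\<in>F. fun_det n (gram v T)) \<le> fun_det n (gram v K)"
proof -
  have "fun_det n (gram v T) = cauchy_binet_coeff n v T" if T: "T \<in> F" for T
  proof -
    have fin: "finite T" using T K F by (auto intro: finite_subset)
    have "cauchy_binet_coeff n v R = 0" if R: "R \<subset> T" for R
    proof -
      have finR: "finite R" using R fin by (auto intro: finite_subset)
      \<comment> \<open>A vanishing sum of nonnegative coefficients forces each of them to vanish,
        including that of \<open>R\<close> itself.\<close>
      have "(\<Sum>S\<in>Pow R. cauchy_binet_coeff n v S) = 0"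
        using minimal[OF T R] fun_det_gram_eq_sum_coeff[OF finR] by simp
      then show ?thesis
        using finR
        by (subst (asm) sum_nonneg_eq_0_iff)
          (auto intro!: cauchy_binet_coeff_nonneg intro: finite_subset)
    qed
    then show ?thesis
      unfolding fun_det_gram_eq_sum_coeff[OF fin]
      using fin by (subst sum.remove[of _ T]) (auto intro!: sum.neutral)
  qed
  then have "(\<Sum>T\<in>F. fun_det n (gram v T)) = (\<Sum>T\<in>F. cauchy_binet_coeff n v T)" by simp
  also have "\<dots> \<le> (\<Sum>T\<in>Pow K. cauchy_binet_coeff n v T)"
    using K F by (intro sum_mono2 cauchy_binet_coeff_nonneg) (auto intro: finite_subset)
  finally show ?thesis unfolding fun_det_gram_eq_sum_coeff[OF K] .
qed

section \<open>Spanning trees\<close>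

text \<open>Applied to the Laplacian of a tree, this is the source of the factor
  \<open>n\<^sup>2\<close> in the final bound.\<close>

lemma fun_det_zero_sums_plus_one:
  fixes l :: "nat \<Rightarrow> nat \<Rightarrow> int"
  assumes "0 < n"
    and row: "\<And>i. i < n \<Longrightarrow> (\<Sum>j<n. l i j) = 0"
    and col: "\<And>j. j < n \<Longrightarrow> (\<Sum>i<n. l i j) = 0"
  shows "\<exists>m::int. fun_det n (\<lambda>i j. real_of_int (l i j) + 1) = (real n)\<^sup>2 * real_of_int m"
proof -
  obtain k where n: "n = Suc k" using assms(1) by (cases n) auto
  txt \<open>
    Adding all rows to row 0 and then all columns to column 0 gives \<open>b\<close>; its pivot is \<open>n\<^sup>2\<close>, with
    Schur complement the integer matrix \<open>l\<close> without row and column 0.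
  \<close>
  let ?U = "mat n n (\<lambda>(i, j). if i = 0 then 1 else of_bool (j = i)) :: real mat"
  let ?A = "mat n n (\<lambda>(i, j). real_of_int (l i j) + 1)"
  let ?C = "mat n n (\<lambda>(i, j). if i = 0 then real n else real_of_int (l i j) + 1)"
  define b where "b i j = (if i = 0 then if j = 0 then (real n)\<^sup>2 else real n
    else if j = 0 then real n else real_of_int (l i j) + 1)" for i j
  have row': "(\<Sum>j<n. real_of_int (l i j) + 1) = real n" if "i < n" for i
    using row[OF that] by (simp add: sum.distrib flip: of_int_sum)
  have col': "(\<Sum>i<n. real_of_int (l i j) + 1) = real n" if "j < n" for j
    using col[OF that] by (simp add: sum.distrib flip: of_int_sum)
  have UA: "?U * ?A = ?C"
    by (rule eq_matI)
      (simp_all add: scalar_prod_def col' sum_mult_of_bool_single flip: lessThan_atLeast0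
        del: sum_of_bool_mult_eq)
  have CU: "?C * ?U\<^sup>T = mat n n (\<lambda>(i, j). b i j)"
    by (rule eq_matI)
      (simp_all add: scalar_prod_def row' sum_mult_of_bool_single b_def power2_eq_square
        flip: lessThan_atLeast0 del: sum_mult_of_bool_eq)
  have "det ?U = prod_list (diag_mat ?U)"
    by (rule det_upper_triangular[of _ n]) auto
  also have "\<dots> = 1"
    unfolding prod_list_diag_prod by (auto intro!: prod.neutral)
  finally have U: "det ?U = 1" .
  have "fun_det n b = det ?C * det (?U\<^sup>T)"
    unfolding CU[symmetric] by (rule det_mult) auto
  also have "det ?C = det ?U * det ?A"
    unfolding UA[symmetric] by (rule det_mult) auto
  also have "det (?U\<^sup>T) = det ?U" by (rule det_transpose) auto
  finally have "det ?A = fun_det (Suc k) b" using U n by simp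
  \<comment> \<open>The Schur correction is \<open>n * n / n\<^sup>2 = 1\<close>, which cancels the
    added 1 in every remaining entry.\<close>
  also have "\<dots> = (real n)\<^sup>2 * fun_det k (\<lambda>i j. real_of_int (l (Suc i) (Suc j)))"
    by (subst fun_det_Suc_pivot) (simp_all add: b_def n power2_eq_square)
  also have "mat k k (\<lambda>(i, j). real_of_int (l (Suc i) (Suc j))) =
      map_mat real_of_int (mat k k (\<lambda>(i, j). l (Suc i) (Suc j)))"
    by (rule eq_matI) auto
  finally show ?thesis unfolding of_int_hom.hom_det by blast
qed

section \<open>Walks, and the effect of deleting a tree edge\<close>

text \<open>A shortest walk with the given ends repeats no vertex, since the stretch between two
  occurrences could be cut out.\<close>

lemma graph_walk_reduce:
  assumes "graph_walk G xs"
  obtains ys where "graph_walk G ys" "hd ys = hd xs" "last ys = last xs" "distinct ys"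
proof -
  let ?P = "\<lambda>ys. graph_walk G ys \<and> hd ys = hd xs \<and> last ys = last xs"
  obtain ys where ys: "?P ys" and min: "\<And>zs. ?P zs \<Longrightarrow> length ys \<le> length zs"
    using ex_has_least_nat[of ?P xs length] assms by auto
  have "distinct ys"
  proof (rule ccontr)
    assume "\<not> distinct ys"
    then obtain as bs cs a where split: "ys = as @ [a] @ bs @ [a] @ cs"
      using not_distinct_decomp by blast
    have "?P (as @ [a] @ cs)"
      using ys unfolding split graph_walk_def
      by (cases as; cases cs) (auto simp: successively_append_iff successively_Cons hd_append)
    from min[OF this] show False by (simp add: split)
  qed
  with ys show ?thesis by (auto intro: that)
qed

lemma graph_walk_constant:
  assumes "graph_walk (V, T) xs" and "\<And>u v. {u, v} \<in> T \<Longrightarrow> y u = y v"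
  shows "y (hd xs) = y (last xs)"
proof -
  have "successively (\<lambda>u v. y u = y v) xs" "xs \<noteq> []"
    using assms by (auto simp: graph_walk_def elim: successively_mono)
  then show ?thesis
    by (induction xs) (auto simp: successively_Cons)
qed

lemma graph_walk_snoc:
  assumes "graph_walk (V, T) xs" "{last xs, w} \<in> T" "w \<in> V"
  shows "graph_walk (V, T) (xs @ [w])"
  using assms by (auto simp: graph_walk_def successively_append_iff)

text \<open>A walk between the ends of an edge that avoids this edge reduces to a path, which the
  edge closes to a cycle.\<close>

lemma tree_graph_no_bypass:
  assumes tree: "tree_graph (V, T)" and e: "{u, w} \<in> T" "u \<noteq> w"
    and xs: "graph_walk (V, T - {{u, w}}) xs"
  shows "\<not> (hd xs = u \<and> last xs = w)"
proof
  assume ends: "hd xs = u \<and> last xs = w"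
  obtain ys where ys: "graph_walk (V, T - {{u, w}}) ys" "hd ys = u" "last ys = w" "distinct ys"
    using graph_walk_reduce[OF xs] ends by metis
  have "graph_walk (V, T) ys"
    using ys(1) by (auto simp: graph_walk_def elim: successively_mono)
  \<comment> \<open>One vertex would force \<open>u = w\<close>, and two vertices would use the
    deleted edge.\<close>
  moreover have "3 \<le> length ys"
  proof (rule ccontr)
    assume "\<not> 3 \<le> length ys"
    moreover have "ys \<noteq> []" using ys(1) by (simp add: graph_walk_def)
    ultimately consider a where "ys = [a]" | a b where "ys = [a, b]"
      by (cases ys rule: remdups_adj.cases) (auto simp: Suc_le_eq numeral_3_eq_3)
    then show False
      using ys e by cases (auto simp: graph_walk_def)
  qed
  moreover have "{last ys, hd ys} \<in> T" using ys e by (simp add: insert_commute)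
  ultimately have "graph_cycle (V, T) ys" using ys(4) by (simp add: graph_cycle_def)
  then show False using tree by (auto simp: tree_graph_def)
qed

text \<open>
  Here \<open>s\<close> and \<open>t\<close> orient the edges and \<open>h\<close> numbers the vertices. The vector \<open>inc (Some e)\<close> is the
  oriented incidence vector of \<open>e\<close>, and \<open>inc None\<close> is the all-ones vector.
\<close>

locale indexed_graph =
  fixes V :: "'a set" and E :: "'a set set" and n :: nat
    and h :: "nat \<Rightarrow> 'a" and s t :: "'a set \<Rightarrow> 'a"
  assumes bij: "bij_betw h {..<n} V"
    and n_pos: "0 < n"
    and edge: "e \<in> E \<Longrightarrow> e = {s e, t e} \<and> s e \<noteq> t e \<and> e \<subseteq> V"
begin

section \<open>Gram determinants of incidence vectors\<close>

definition inc :: "'a set option \<Rightarrow> nat \<Rightarrow> int" where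
  "inc k i = (case k of None \<Rightarrow> 1 | Some e \<Rightarrow> of_bool (h i = s e) - of_bool (h i = t e))"

text \<open>For \<open>K = aug T\<close> with \<open>T\<close> a set of edges in \<open>E\<close>,
  this is the determinant of the Laplacian of \<open>T\<close> plus the all-ones matrix.\<close>

abbreviation inc_det :: "'a set option set \<Rightarrow> real" where
  "inc_det K \<equiv> fun_det n (gram (\<lambda>k i. real_of_int (inc k i)) K)"

abbreviation aug :: "'a set set \<Rightarrow> 'a set option set" where
  "aug T \<equiv> insert None (Some ` T)"

lemma finite_V: "finite V"
  using bij bij_betw_finite by blast

lemma card_V: "card V = n"
  using bij_betw_same_card[OF bij] by simp

lemma finite_edges: "T \<subseteq> E \<Longrightarrow> finite T"
  using edge finite_V by (intro finite_subset[of T "Pow V"]) auto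

lemma inc_None_form: "(\<Sum>i<n. real_of_int (inc None i) * y (h i)) = (\<Sum>v\<in>V. y v)"
  using sum.reindex_bij_betw[OF bij, of y] by (simp add: inc_def)

text \<open>The general ring serves both the integer row sums of the Laplacian and the real kernel
  vectors.\<close>

lemma inc_Some_form:
  fixes y :: "'a \<Rightarrow> 'b :: comm_ring_1"
  assumes "e \<in> E"
  shows "(\<Sum>i<n. of_int (inc (Some e) i) * y (h i)) = y (s e) - y (t e)"
proof -
  have "s e \<in> V" "t e \<in> V" using edge[OF assms] by auto
  then have "V \<inter> {v. v = s e} = {s e}" "V \<inter> {v. v = t e} = {t e}" by auto
  moreover have "(\<Sum>i<n. of_int (inc (Some e) i) * y (h i)) =
      (\<Sum>v\<in>V. of_bool (v = s e) * y v - of_bool (v = t e) * y v)"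
    using sum.reindex_bij_betw[OF bij, of "\<lambda>v. of_bool (v = s e) * y v - of_bool (v = t e) * y v"]
    by (simp add: inc_def left_diff_distrib)
  ultimately show ?thesis
    using finite_V by (simp add: sum_subtractf)
qed

lemma inc_det_eq_0_iff:
  assumes "finite K"
  shows "inc_det K = 0 \<longleftrightarrow>
    (\<exists>y. (\<exists>v\<in>V. y v \<noteq> 0) \<and> (\<forall>k\<in>K. (\<Sum>i<n. real_of_int (inc k i) * y (h i)) = 0))"
  unfolding fun_det_gram_eq_0_iff[OF assms]
proof safe
  fix x :: "nat \<Rightarrow> real" and i
  assume x: "i < n" "x i \<noteq> 0" "\<forall>k\<in>K. (\<Sum>i<n. real_of_int (inc k i) * x i) = 0"
  define y where "y = x \<circ> the_inv_into {..<n} h"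
  have y: "y (h i) = x i" if "i < n" for i
    using bij that by (simp add: y_def bij_betw_def the_inv_into_f_f)
  have "h i \<in> V" using x(1) bij by (auto simp: bij_betw_def)
  then show "\<exists>y. (\<exists>v\<in>V. y v \<noteq> 0) \<and> (\<forall>k\<in>K. (\<Sum>i<n. real_of_int (inc k i) * y (h i)) = 0)"
    using x y by (intro exI[of _ y] conjI bexI[of _ "h i"]) auto
next
  fix y :: "'a \<Rightarrow> real" and v
  assume y: "v \<in> V" "y v \<noteq> 0" "\<forall>k\<in>K. (\<Sum>i<n. real_of_int (inc k i) * y (h i)) = 0"
  then obtain i where "i < n" "v = h i" using bij by (auto simp: bij_betw_def)
  with y show "\<exists>x. (\<exists>i<n. x i \<noteq> 0) \<and> (\<forall>k\<in>K. (\<Sum>i<n. real_of_int (inc k i) * x i) = 0)"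
    by (intro exI[of _ "\<lambda>i. y (h i)"]) auto
qed

text \<open>The determinant is an integer multiple of \<open>n\<^sup>2\<close> and nonnegative, so
  it suffices that it is nonzero. A kernel vector agrees at the ends of each edge, hence is constant
  by connectedness, and its sum is zero, so it vanishes.\<close>

lemma inc_det_connected:
  assumes T: "T \<subseteq> E" and conn: "connected_graph (V, T)"
  shows "(real n)\<^sup>2 \<le> inc_det (aug T)"
proof -
  have fin: "finite T" by (rule finite_edges[OF T])
  \<comment> \<open>The integer Laplacian of \<open>(V, T)\<close>.\<close>
  define l where "l i j = (\<Sum>e\<in>T. inc (Some e) i * inc (Some e) j)" for i j
  have sum0: "(\<Sum>i<n. inc (Some e) i) = 0" if "e \<in> T" for e
    using inc_Some_form[of e "\<lambda>_. 1 :: int"] that T by auto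
  have "(\<Sum>j<n. l i j) = (\<Sum>e\<in>T. inc (Some e) i * (\<Sum>j<n. inc (Some e) j))" for i
    unfolding l_def sum_distrib_left by (rule sum.swap)
  then have row: "(\<Sum>j<n. l i j) = 0" for i by (simp add: sum0)
  have "l i j = l j i" for i j by (simp add: l_def mult.commute)
  then have col: "(\<Sum>i<n. l i j) = 0" for j using row[of j] by simp
  have "gram (\<lambda>k i. real_of_int (inc k i)) (aug T) = (\<lambda>i j. real_of_int (l i j) + 1)"
    using fin by (intro ext) (simp add: gram_def l_def sum.reindex inc_def)
  then obtain m :: int where m: "inc_det (aug T) = (real n)\<^sup>2 * real_of_int m"
    using fun_det_zero_sums_plus_one[of n l] n_pos row col by auto
  have "inc_det (aug T) \<noteq> 0"
  proof
    assume "inc_det (aug T) = 0"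
    then obtain y v where v: "v \<in> V" "y v \<noteq> 0"
      and y: "\<forall>k\<in>aug T. (\<Sum>i<n. real_of_int (inc k i) * y (h i)) = 0"
      using fin by (subst (asm) inc_det_eq_0_iff) auto
    have edge_eq: "y a = y b" if "{a, b} \<in> T" for a b
    proof -
      have "{a, b} \<in> E" using that T by auto
      moreover have "y (s {a, b}) = y (t {a, b})"
        using inc_Some_form[OF calculation, of y] y that by auto
      ultimately show ?thesis using edge[of "{a, b}"] by (metis doubleton_eq_iff)
    qed
    have "y u = y v" if u: "u \<in> V" for u
    proof -
      obtain xs where "graph_walk (V, T) xs" "hd xs = u" "last xs = v"
        using conn u v(1) by (fastforce simp: connected_graph_def)
      then show ?thesis using graph_walk_constant[of V T xs y] edge_eq by simp
    qed
    then have "(\<Sum>u\<in>V. y u) = real n * y v" by (simp add: card_V)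
    moreover have "(\<Sum>u\<in>V. y u) = 0" using y inc_None_form[of y] by simp
    ultimately show False using v n_pos by simp
  qed
  moreover have "0 \<le> inc_det (aug T)"
    using psd_hadamard[OF psd_gram] by blast
  ultimately have "0 < (real n)\<^sup>2 * real_of_int m" using m by linarith
  then have "1 \<le> m" using n_pos by (simp add: zero_less_mult_iff)
  then have "(real n)\<^sup>2 * 1 \<le> (real n)\<^sup>2 * real_of_int m" by (intro mult_left_mono) auto
  then show ?thesis unfolding m by simp
qed

lemma inc_det_bridge:
  assumes T: "T \<subseteq> E" and tree: "tree_graph (V, T)" and e: "e \<in> T"
    and K: "K \<subseteq> aug (T - {e})"
  shows "inc_det K = 0"
proof -
  have "finite (aug (T - {e}))" using finite_edges[OF T] by simp
  then have fin: "finite K" using K finite_subset by blast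
  have e': "e = {s e, t e}" "s e \<noteq> t e" "s e \<in> V" "t e \<in> V" using edge[of e] e T by auto
  txt \<open>
    The kernel vector \<open>y\<close> has sum zero and is constant on each side of the cut that removing \<open>e\<close>
    opens between \<open>C\<close> and its complement.
  \<close>
  define C where "C = {w \<in> V. \<exists>xs. graph_walk (V, T - {e}) xs \<and> hd xs = s e \<and> last xs = w}"
  define y where "y v = real n * of_bool (v \<in> C) - real (card C)" for v
  have "graph_walk (V, T - {e}) [s e]" using e' by (simp add: graph_walk_def)
  then have sC: "s e \<in> C" unfolding C_def using e' by force
  have tC: "t e \<notin> C"
    using tree_graph_no_bypass[OF tree, of "s e" "t e"] e' e unfolding C_def by force
  \<comment> \<open>The values of \<open>y\<close> inside and outside \<open>C\<close> differ by
    \<open>n\<close>, so they cannot both be zero.\<close>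
  have "y (s e) \<noteq> 0 \<or> y (t e) \<noteq> 0" using sC tC n_pos by (auto simp: y_def)
  then have nz: "\<exists>v\<in>V. y v \<noteq> 0" using e' by blast
  have closed: "w \<in> C" if v: "v \<in> C" and vw: "{v, w} \<in> T - {e}" for v w
  proof -
    have "w \<in> V" using vw T edge[of "{v, w}"] by auto
    obtain xs where xs: "graph_walk (V, T - {e}) xs" "hd xs = s e" "last xs = v"
      using v by (auto simp: C_def)
    then have "graph_walk (V, T - {e}) (xs @ [w])"
      using vw \<open>w \<in> V\<close> by (intro graph_walk_snoc) simp_all
    moreover have "hd (xs @ [w]) = s e" using xs by (simp add: graph_walk_def)
    ultimately show ?thesis using \<open>w \<in> V\<close> unfolding C_def by force
  qed
  have "(\<Sum>i<n. real_of_int (inc k i) * y (h i)) = 0" if k: "k \<in> K" for k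
  proof (cases k)
    case None
    have "V \<inter> {v. v \<in> C} = C" by (auto simp: C_def)
    then have "(\<Sum>v\<in>V. y v) = 0"
      using finite_V by (simp add: y_def sum_subtractf card_V flip: sum_distrib_left)
    then show ?thesis using None inc_None_form by simp
  next
    case (Some e1)
    then have e1: "e1 \<in> T - {e}" "e1 \<in> E" using k K T by auto
    then have "{s e1, t e1} \<in> T - {e}" using edge[of e1] by simp
    then have "s e1 \<in> C \<longleftrightarrow> t e1 \<in> C" using closed by (metis insert_commute)
    then show ?thesis using Some e1 inc_Some_form[of e1 y] by (simp add: y_def)
  qed
  then show ?thesis unfolding inc_det_eq_0_iff[OF fin] using nz by blast
qed

text \<open>Supplies the minimality hypothesis of \<open>sum_fun_det_gram_le\<close>. If an edge is
  missing, the cut vector of \<open>inc_det_bridge\<close> lies in the kernel; if the all-ones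
  vector is missing, the constant vector does.\<close>

lemma inc_det_proper_subset_tree:
  assumes T: "T \<subseteq> E" and tree: "tree_graph (V, T)" and R: "R \<subset> aug T"
  shows "inc_det R = 0"
proof (cases "None \<in> R")
  case True
  then obtain e where "e \<in> T" "Some e \<notin> R" using R by auto
  then show ?thesis using R by (intro inc_det_bridge[OF T tree, of e]) auto
next
  case False
  then have RT: "R \<subseteq> Some ` T" using R by auto
  then have "finite R" using finite_edges[OF T] finite_subset by blast
  moreover have "(\<Sum>i<n. real_of_int (inc k i) * 1) = 0" if "k \<in> R" for k
    using that RT T inc_Some_form[of _ "\<lambda>_. 1 :: real"] by auto
  moreover have "V \<noteq> {}" using card_V n_pos by auto
  ultimately show ?thesis
    by (subst inc_det_eq_0_iff) (auto intro!: exI[of _ "\<lambda>_. 1"])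
qed

text \<open>Hadamard's inequality: a diagonal entry collects 1 from \<open>None\<close> and 1 from
  each incident edge, the squared incidence entries being 0 or 1.\<close>

lemma inc_det_le_degrees:
  "inc_det (aug E) \<le> (\<Prod>v\<in>V. 1 + real (vertex_degree (V, E) v))"
proof -
  have fin: "finite E" using finite_edges by blast
  have diag: "gram (\<lambda>k i. real_of_int (inc k i)) (aug E) i i = 1 + real (vertex_degree (V, E) (h i))" for i
  proof -
    have "real_of_int (inc (Some e) i) * real_of_int (inc (Some e) i) = of_bool (h i \<in> e)"
      if "e \<in> E" for e
    proof -
      have "h i \<in> e \<longleftrightarrow> h i = s e \<or> h i = t e" using edge[OF that] by blast
      then show ?thesis using edge[OF that] by (auto simp: inc_def)
    qed
    then have "(\<Sum>e\<in>E. real_of_int (inc (Some e) i) * real_of_int (inc (Some e) i)) =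
        (\<Sum>e\<in>E. of_bool (h i \<in> e))"
      by (intro sum.cong) auto
    also have "\<dots> = real (card (E \<inter> {e. h i \<in> e}))" using fin by simp
    also have "E \<inter> {e. h i \<in> e} = {e \<in> E. h i \<in> e}" by auto
    finally show ?thesis
      using fin by (simp add: gram_def sum.reindex vertex_degree_def inc_def)
  qed
  have "inc_det (aug E) \<le> (\<Prod>i<n. gram (\<lambda>k i. real_of_int (inc k i)) (aug E) i i)"
    using psd_hadamard[OF psd_gram] by blast
  also have "\<dots> = (\<Prod>v\<in>V. 1 + real (vertex_degree (V, E) v))"
    unfolding diag by (rule prod.reindex_bij_betw[OF bij])
  finally show ?thesis .
qed

lemma spanning_trees_bound:
  "real (num_spanning_trees (V, E)) * (real n)\<^sup>2 \<le> (\<Prod>v\<in>V. 1 + real (vertex_degree (V, E) v))"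
proof -
  let ?S = "spanning_trees (V, E)" and ?f = "\<lambda>H. aug (graph_edges H)"
  have S: "graph_edges H \<subseteq> E \<and> tree_graph (V, graph_edges H)" if "H \<in> ?S" for H
    using that by (cases H) (auto simp: spanning_trees_def subgraph_of_def)
  \<comment> \<open>All spanning trees share the vertex set \<open>V\<close>, so their edge sets
    tell them apart and the sum over trees becomes a sum over distinct index sets.\<close>
  have inj: "inj_on ?f ?S"
  proof (rule inj_onI)
    fix H H' assume HH: "H \<in> ?S" "H' \<in> ?S" "?f H = ?f H'"
    then have "Some ` graph_edges H = Some ` graph_edges H'" by (auto simp: insert_eq_iff)
    then have "graph_edges H = graph_edges H'" by (simp add: inj_image_eq_iff)
    then show "H = H'" using HH by (auto simp: spanning_trees_def intro: prod_eqI)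
  qed
  have "real (num_spanning_trees (V, E)) * (real n)\<^sup>2 = (\<Sum>H\<in>?S. (real n)\<^sup>2)"
    by (simp add: num_spanning_trees_def)
  also have "\<dots> \<le> (\<Sum>H\<in>?S. inc_det (?f H))"
    using S by (intro sum_mono inc_det_connected) (auto simp: tree_graph_def)
  also have "\<dots> = (\<Sum>K\<in>?f ` ?S. inc_det K)" by (simp add: sum.reindex[OF inj])
  also have "\<dots> \<le> inc_det (aug E)"
  proof (rule sum_fun_det_gram_le)
    show "finite (aug E)" using finite_edges by blast
    show "?f ` ?S \<subseteq> Pow (aug E)" using S by blast
    show "inc_det R = 0" if "K \<in> ?f ` ?S" "R \<subset> K" for K R
      using that S inc_det_proper_subset_tree by blast
  qed
  also note inc_det_le_degrees
  finally show ?thesis .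
qed

end

theorem theorem1p1:
  fixes G :: "'a ugraph" and n :: nat and d :: "nat \<Rightarrow> nat"
  assumes "finite_simple_graph G"
    and "card (graph_verts G) = n" and "n \<ge> 1"
    and "mono_on {1..n} d"
    and "image_mset d (mset_set {1..n}) = image_mset (vertex_degree G) (mset_set (graph_verts G))"
  shows "real (num_spanning_trees G) \<le> (\<Prod>i=1..n. 1 + real (d i)) / (real n)\<^sup>2"
proof -
  obtain V E where G: "G = (V, E)" by (cases G)
  have V: "finite V" "card V = n" and E: "\<And>e. e \<in> E \<Longrightarrow> e \<subseteq> V \<and> card e = 2"
    using assms(1,2) by (auto simp: G finite_simple_graph_def simple_graph_def)
  obtain h where h: "bij_betw h {..<n} V"
    using ex_bij_betw_nat_finite[OF V(1)] V(2) by (auto simp: lessThan_atLeast0)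
  \<comment> \<open>Choosing an ordered pair of ends for each edge fixes an arbitrary
    orientation.\<close>
  have "\<forall>e\<in>E. \<exists>p. e = {fst p, snd p} \<and> fst p \<noteq> snd p"
    using E by (fastforce simp: card_2_iff)
  then obtain p where p: "\<And>e. e \<in> E \<Longrightarrow> e = {fst (p e), snd (p e)} \<and> fst (p e) \<noteq> snd (p e)"
    by metis
  interpret indexed_graph V E n h "fst \<circ> p" "snd \<circ> p"
    using h p E assms(3) by unfold_locales auto
  \<comment> \<open>The product depends only on the multiset of degrees, which allows passing from
    positions to vertices.\<close>
  have "(\<Prod>i=1..n. 1 + real (d i)) =
      prod_mset (image_mset (\<lambda>k. 1 + real k) (image_mset d (mset_set {1..n})))"
    by (simp add: prod_unfold_prod_mset image_mset.compositionality o_def)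
  also have "\<dots> = (\<Prod>v\<in>V. 1 + real (vertex_degree G v))"
    unfolding assms(5) by (simp add: prod_unfold_prod_mset image_mset.compositionality o_def G)
  finally have "real (num_spanning_trees G) * (real n)\<^sup>2 \<le> (\<Prod>i=1..n. 1 + real (d i))"
    using spanning_trees_bound by (simp add: G)
  then show ?thesis using assms(3) by (simp add: field_simps)
qed

end
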